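(* Let $n$ be a positive integer and let $\alpha=(\alpha_1,\ldots,\alpha_r)\vdash n$ be a partition with parts $\alpha_1\ge\cdots\ge\alpha_r\ge1$. Then $\mathcal{S}_\alpha\subseteq\mathcal{B}_\alpha$. That is, if $\sigma\in S_n$ has cycle type $\alpha$ and $\lambda=\operatorname{sh}(\sigma)$, then $$\lambda'_1\le n-r+\#\{i:\alpha_i=2\}+\delta_{1,\alpha_r}\qquad\text{and}\qquad \lambda_1\le n-r+\#\{i:\alpha_i=1\}.$$
   Context: $\lambda\vdash n$ means $\lambda$ is a partition of $n$; $\lambda'$ denotes the conjugate partition, so $\lambda_1$ is the number of columns and $\lambda'_1$ the number of rows of the Young diagram of $\lambda$. For $\sigma\in S_n$, $\operatorname{sh}(\sigma)$ is the common shape of the pair of standard Young tableaux associated to $\sigma$ by the Robinson--Schensted correspondence (row insertion of the one-line notation $[\sigma_1,\ldots,\sigma_n]$). $\mathcal{C}_\alpha\subset S_n$ is the set of permutations of cycle type $\alpha$, $\mathcal{S}_\alpha=\{\operatorname{sh}(\sigma):\sigma\in\mathcal{C}_\alpha\}$, and $$\mathcal{B}_\alpha=\{\lambda\vdash n:\ \lambda'_1\le n-r+\#\{i:\alpha_i=2\}+\delta_{1,\alpha_r},\ \ \lambda_1\le n-r+\#\{i:\alpha_i=1\}\},$$ where $\delta_{1,\alpha_r}$ is $1$ if $\alpha_r=1$ and $0$ otherwise. *)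

theory Defs
  imports "HOL-Combinatorics.Orbits" "HOL-Library.Multiset"
begin

section \<open>Integer partitions\<close>

definition is_partition_of :: "nat list \<Rightarrow> nat \<Rightarrow> bool"  (infix \<open>\<turnstile>p\<close> 50) where
  "la \<turnstile>p n \<longleftrightarrow> sorted_wrt (\<ge>) la \<and> (\<forall>k\<in>set la. k \<ge> 1) \<and> sum_list la = n"

text \<open>Entry \<open>j\<close> (counted from 0) is the length of column \<open>j + 1\<close> of the Young diagram, which
  is the number of parts greater than \<open>j\<close>. The diagram has as many columns as its first part.\<close>

fun conjugate :: "nat list \<Rightarrow> nat list" where
  "conjugate [] = []"
| "conjugate (k # ks) = map (\<lambda>j. length (filter (\<lambda>p. j < p) (k # ks))) [0..<k]"

section \<open>The Robinson--Schensted correspondence\<close>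

text \<open>A tableau is the list of its rows, from top to bottom.\<close>

type_synonym 'a tableau = "'a list list"

definition shape :: "'a tableau \<Rightarrow> nat list" where
  "shape T = map length T"

text \<open>Inserting \<open>x\<close> replaces the leftmost entry greater than \<open>x\<close>, which is returned as the bumped
  entry. If there is none, then \<open>x\<close> is put at the end of the row.\<close>

fun row_insert :: "'a::linorder \<Rightarrow> 'a list \<Rightarrow> 'a list \<times> 'a option" where
  "row_insert x [] = ([x], None)"
| "row_insert x (y # ys) =
     (if x < y then (x # ys, Some y)
      else (case row_insert x ys of (zs, b) \<Rightarrow> (y # zs, b)))"

fun tableau_insert :: "'a::linorder \<Rightarrow> 'a tableau \<Rightarrow> 'a tableau" where
  "tableau_insert x [] = [[x]]"
| "tableau_insert x (R # T) =
     (case row_insert x R of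
        (R', None) \<Rightarrow> R' # T
      | (R', Some y) \<Rightarrow> R' # tableau_insert y T)"

text \<open>The index (from 0) of the row that gets the new box when \<open>x\<close> is inserted.\<close>

fun new_box_row :: "'a::linorder \<Rightarrow> 'a tableau \<Rightarrow> nat" where
  "new_box_row x [] = 0"
| "new_box_row x (R # T) =
     (case row_insert x R of
        (R', None) \<Rightarrow> 0
      | (R', Some y) \<Rightarrow> Suc (new_box_row y T))"

definition add_box :: "nat \<Rightarrow> 'a \<Rightarrow> 'a tableau \<Rightarrow> 'a tableau" where
  "add_box k i T = (if k < length T then T[k := T ! k @ [i]] else T @ [[i]])"

fun rs_step :: "nat \<times> 'a::linorder \<Rightarrow> 'a tableau \<times> nat tableau \<Rightarrow> 'a tableau \<times> nat tableau" where
  "rs_step (i, x) (P, Q) = (tableau_insert x P, add_box (new_box_row x P) i Q)"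

text \<open>The pair of the insertion tableau and the recording tableau of a word.\<close>

definition robinson_schensted :: "'a::linorder list \<Rightarrow> 'a tableau \<times> nat tableau" where
  "robinson_schensted w = fold rs_step (enumerate 1 w) ([], [])"

definition one_line :: "nat \<Rightarrow> (nat \<Rightarrow> nat) \<Rightarrow> nat list" where
  "one_line n \<sigma> = map \<sigma> [1..<Suc n]"

definition sh :: "nat \<Rightarrow> (nat \<Rightarrow> nat) \<Rightarrow> nat list" where
  "sh n \<sigma> = shape (fst (robinson_schensted (one_line n \<sigma>)))"

lemma length_row_insert:
  "length (fst (row_insert x R)) =
     (if snd (row_insert x R) = None then Suc (length R) else length R)"
  by (induction R) (auto split: prod.splits)

lemma shape_tableau_insert:
  assumes "shape P = shape Q"
  shows "shape (tableau_insert x P) = shape (add_box (new_box_row x P) i Q)"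
  using assms
proof (induction P arbitrary: x Q)
  case Nil
  then show ?case by (simp add: shape_def add_box_def)
next
  case (Cons R T)
  then obtain R2 T2 where Q: "Q = R2 # T2" "length R = length R2" "shape T = shape T2"
    by (cases Q) (auto simp: shape_def)
  obtain R' b where b: "row_insert x R = (R', b)" by fastforce
  with length_row_insert[of x R]
  have len: "length R' = (if b = None then Suc (length R) else length R)" by simp
  show ?case
  proof (cases b)
    case None
    then show ?thesis using Q b len by (simp add: shape_def add_box_def)
  next
    case (Some y)
    have "shape (tableau_insert y T) = shape (add_box (new_box_row y T) i T2)"
      using Cons.IH Q(3) .
    then show ?thesis using Q b len Some by (auto simp: shape_def add_box_def)
  qed
qed

text \<open>The shape is common to the two tableaux, so \<^const>\<open>sh\<close> does not depend on which is taken.\<close>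

lemma shape_robinson_schensted:
  fixes w :: "'a::linorder list"
  shows "shape (fst (robinson_schensted w)) = shape (snd (robinson_schensted w))"
proof -
  have fold: "shape (fst PQ) = shape (snd PQ) \<Longrightarrow>
      shape (fst (fold rs_step xs PQ)) = shape (snd (fold rs_step xs PQ))"
    for xs :: "(nat \<times> 'a) list" and PQ
  proof (induction xs arbitrary: PQ)
    case (Cons z xs)
    have "shape (fst (rs_step z PQ)) = shape (snd (rs_step z PQ))"
      using Cons.prems by (cases z; cases PQ) (simp add: shape_tableau_insert)
    then show ?case using Cons.IH by simp
  qed simp
  show ?thesis unfolding robinson_schensted_def by (rule fold) (simp add: shape_def)
qed

section \<open>Cycle types\<close>

text \<open>The cycles, fixed points included, correspond to the orbits on \<open>{1..n}\<close>. Each orbit occurs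
  once in \<^term>\<open>orbit \<sigma> ` {1..n}\<close>, so it contributes one part.\<close>

definition cycle_type :: "nat \<Rightarrow> (nat \<Rightarrow> nat) \<Rightarrow> nat multiset" where
  "cycle_type n \<sigma> = image_mset card (mset_set (orbit \<sigma> ` {1..n}))"

definition conj_class :: "nat \<Rightarrow> nat list \<Rightarrow> (nat \<Rightarrow> nat) set" where
  "conj_class n \<alpha> = {\<sigma>. \<sigma> permutes {1..n} \<and> cycle_type n \<sigma> = mset \<alpha>}"

definition shapes :: "nat \<Rightarrow> nat list \<Rightarrow> nat list set" where
  "shapes n \<alpha> = sh n ` conj_class n \<alpha>"

text \<open>Here \<open>r\<close> is \<^term>\<open>length \<alpha>\<close>. If \<^prop>\<open>\<alpha> \<turnstile>p n\<close>, then \<open>r \<le> n\<close> because the parts are positive,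
  so the subtraction on natural numbers does not truncate. The lists \<open>la\<close>, \<open>conjugate la\<close> and
  \<open>\<alpha>\<close> are nonempty if \<open>n > 0\<close>.\<close>

definition bound_set :: "nat \<Rightarrow> nat list \<Rightarrow> nat list set" where
  "bound_set n \<alpha> = {la. la \<turnstile>p n \<and>
     hd (conjugate la) \<le> n - length \<alpha> + card {i. i < length \<alpha> \<and> \<alpha> ! i = 2}
                            + (if last \<alpha> = 1 then 1 else 0) \<and>
     hd la \<le> n - length \<alpha> + card {i. i < length \<alpha> \<and> \<alpha> ! i = 1}}"

end

theory Submission
  imports Defs "HOL-Library.Sublist"
begin

text \<open>Both bounds rest on one half of Schensted's theorem: a word \<open>w\<close> has a weakly increasing
  subsequence as long as the first row of its insertion tableau, and a strictly decreasing one as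
  long as the first column. For the row this is read off the insertion
  (\<open>increasing_subseq_first_row\<close>). For the column, the tableau below the first row is the insertion
  tableau of the word \<open>u\<close> of the entries bumped from the first row
  (\<open>insertion_tableau_first_row\<close>), so it is enough that a decreasing subsequence of \<open>u\<close> of length
  \<open>k > 0\<close> gives one of \<open>w\<close> of length \<open>k + 1\<close> (\<open>decreasing_subseq_bumped\<close>).

  For the word of a permutation \<open>\<sigma>\<close> such a subsequence is a set \<open>I\<close> of positions on which \<open>\<sigma>\<close> is
  monotone. Every cycle that is not contained in \<open>I\<close> has a point outside \<open>I\<close>, so that
  \<open>card I \<le> n - r + c\<close>, where \<open>c\<close> is the number of cycles inside \<open>I\<close> (\<open>card_add_orbits_le\<close>).
  If \<open>\<sigma>\<close> is increasing on \<open>I\<close>, then a cycle inside \<open>I\<close> is a fixed point, because an increasing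
  map moves no point of a finite cycle. If \<open>\<sigma>\<close> is decreasing on \<open>I\<close>, then \<open>\<sigma> \<circ> \<sigma>\<close> is increasing on
  every cycle inside \<open>I\<close>, so these cycles have length at most 2; and at most one of them is a
  fixed point, because \<open>\<sigma>\<close> reverses the order of any two points of \<open>I\<close>.\<close>

section \<open>Row insertion\<close>

lemma row_insert_NoneD: "row_insert x R = (R', None) \<Longrightarrow> R' = R @ [x] \<and> (\<forall>c\<in>set R. c \<le> x)"
  by (induction R arbitrary: R') (auto split: if_splits prod.splits)

lemma row_insert_SomeD:
  "row_insert x R = (R', Some y) \<Longrightarrow>
     \<exists>A B. R = A @ y # B \<and> R' = A @ x # B \<and> x < y \<and> (\<forall>c\<in>set A. c \<le> x)"
proof (induction R arbitrary: R')
  case (Cons a R)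
  show ?case
  proof (cases "x < a")
    case True
    then show ?thesis using Cons.prems by (intro exI[of _ "[]"] exI[of _ R]) auto
  next
    case False
    then obtain R'' where R: "row_insert x R = (R'', Some y)" "R' = a # R''"
      using Cons.prems by (auto split: prod.splits)
    then obtain A B where "R = A @ y # B" "R'' = A @ x # B" "x < y" "\<forall>c\<in>set A. c \<le> x"
      using Cons.IH by blast
    then show ?thesis using False R
      by (intro exI[of _ "a # A"] exI[of _ B]) auto
  qed
qed simp

lemma sorted_row_insert:
  assumes "sorted R"
  shows "sorted (fst (row_insert x R))"
proof (cases "row_insert x R")
  case (Pair R' b)
  show ?thesis
  proof (cases b)
    case None
    then show ?thesis using row_insert_NoneD[of x R R'] Pair assms by (auto simp: sorted_append)
  next
    case (Some y)
    then show ?thesis using row_insert_SomeD[of x R R' y] Pair assms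
      by (fastforce simp: sorted_append)
  qed
qed

text \<open>The condition on two consecutive rows of a tableau: the lower row is not longer, and the
  columns increase.\<close>

fun column_strict :: "'a::linorder list \<Rightarrow> 'a list \<Rightarrow> bool" where
  "column_strict R [] = True"
| "column_strict [] (b # S) = False"
| "column_strict (a # R) (b # S) = (a < b \<and> column_strict R S)"

lemma column_strict_length: "column_strict R S \<Longrightarrow> length S \<le> length R"
  by (induction R S rule: column_strict.induct) auto

lemma column_strict_append: "column_strict R S \<Longrightarrow> column_strict (R @ T) S"
  by (induction R S rule: column_strict.induct) auto

lemma column_strict_decrease:
  "column_strict (A @ y # B) S \<Longrightarrow> x < y \<Longrightarrow> column_strict (A @ x # B) S"
proof (induction A arbitrary: S)
  case Nil
  then show ?case by (cases S) auto
next
  case (Cons a A)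
  then show ?case by (cases S) auto
qed

text \<open>An entry bumped from column \<open>j\<close> is less than the entry below it, so it enters the next row
  in column \<open>j\<close> or further to the left. There the entry above it is at most the inserted \<open>x\<close>,
  which is less than the bumped entry.\<close>

lemma column_strict_row_insert:
  "row_insert x R = (R', Some y) \<Longrightarrow> column_strict R S \<Longrightarrow>
     column_strict R' (fst (row_insert y S))"
proof (induction R arbitrary: R' S)
  case (Cons a R)
  show ?case
  proof (cases "x < a")
    case True
    then show ?thesis using Cons.prems by (cases S) auto
  next
    case False
    then obtain R'' where R: "row_insert x R = (R'', Some y)" "R' = a # R''"
      using Cons.prems by (auto split: prod.splits)
    obtain A B where AB: "R = A @ y # B" "R'' = A @ x # B" "x < y"
      using row_insert_SomeD[OF R(1)] by blast
    have ay: "a < y" using False AB(3) by simp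
    show ?thesis
    proof (cases S)
      case Nil
      then show ?thesis using R ay by simp
    next
      case (Cons b S')
      then have ab: "a < b" "column_strict R S'" using Cons.prems(2) by auto
      have "column_strict R'' S'"
        using ab(2) column_strict_decrease AB by blast
      moreover have "column_strict R'' (fst (row_insert y S'))"
        using Cons.IH[OF R(1) ab(2)] .
      ultimately show ?thesis using Cons R ay ab(1) by (auto split: prod.splits)
    qed
  qed
qed simp

section \<open>The insertion tableau, one row at a time\<close>

definition insertion_tableau :: "'a::linorder list \<Rightarrow> 'a tableau" where
  "insertion_tableau w = fold tableau_insert w []"

lemma fst_robinson_schensted: "fst (robinson_schensted w) = insertion_tableau w"
proof -
  have "fst (fold rs_step (enumerate k w) PQ) = fold tableau_insert w (fst PQ)" for k PQ
    by (induction w arbitrary: k PQ) (simp, case_tac PQ, simp)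
  then show ?thesis by (simp add: robinson_schensted_def insertion_tableau_def)
qed

text \<open>The state is the first row, together with the word of the entries bumped from it so far.\<close>

fun bump_step :: "'a::linorder \<Rightarrow> 'a list \<times> 'a list \<Rightarrow> 'a list \<times> 'a list" where
  "bump_step x (R, u) =
     (case row_insert x R of
        (R', None) \<Rightarrow> (R', u)
      | (R', Some y) \<Rightarrow> (R', u @ [y]))"

definition first_row :: "'a::linorder list \<Rightarrow> 'a list" where
  "first_row w = fst (fold bump_step w ([], []))"

definition bumped :: "'a::linorder list \<Rightarrow> 'a list" where
  "bumped w = snd (fold bump_step w ([], []))"

lemma first_row_Nil [simp]: "first_row [] = []"
  and bumped_Nil [simp]: "bumped [] = []"
  by (simp_all add: first_row_def bumped_def)

lemma first_row_snoc: "first_row (w @ [x]) = fst (row_insert x (first_row w))"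
  by (cases "fold bump_step w ([], [])") (auto simp: first_row_def split: prod.splits option.splits)

lemma bumped_snoc:
  "bumped (w @ [x]) = bumped w @ (case snd (row_insert x (first_row w)) of None \<Rightarrow> [] | Some y \<Rightarrow> [y])"
  by (cases "fold bump_step w ([], [])")
    (auto simp: first_row_def bumped_def split: prod.splits option.splits)

text \<open>The invariants of the first row depend only on where the last letter lands, so the analysis
  of its two possible effects is done once, as an induction rule.\<close>

lemma bump_induct [case_names Nil extend bump]:
  assumes "P []"
    and "\<And>w x. P w \<Longrightarrow> first_row (w @ [x]) = first_row w @ [x] \<Longrightarrow> \<forall>c\<in>set (first_row w). c \<le> x \<Longrightarrow>
           bumped (w @ [x]) = bumped w \<Longrightarrow> P (w @ [x])"
    and "\<And>w x y A B. P w \<Longrightarrow> row_insert x (first_row w) = (A @ x # B, Some y) \<Longrightarrow>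
           first_row w = A @ y # B \<Longrightarrow> first_row (w @ [x]) = A @ x # B \<Longrightarrow> x < y \<Longrightarrow>
           \<forall>c\<in>set A. c \<le> x \<Longrightarrow> bumped (w @ [x]) = bumped w @ [y] \<Longrightarrow> P (w @ [x])"
  shows "P w"
proof (induction w rule: rev_induct)
  case Nil
  then show ?case by (rule assms(1))
next
  case (snoc x w)
  obtain R' b where Rb: "row_insert x (first_row w) = (R', b)" by fastforce
  show ?case
  proof (cases b)
    case None
    then have "R' = first_row w @ [x] \<and> (\<forall>c\<in>set (first_row w). c \<le> x)"
      using row_insert_NoneD Rb by blast
    then show ?thesis using snoc Rb None
      by (intro assms(2)) (auto simp: first_row_snoc bumped_snoc)
  next
    case (Some y)
    then obtain A B where AB: "first_row w = A @ y # B" "R' = A @ x # B" "x < y" "\<forall>c\<in>set A. c \<le> x"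
      using row_insert_SomeD Rb by blast
    show ?thesis
    proof (rule assms(3)[OF snoc _ AB(1)])
      show "row_insert x (first_row w) = (A @ x # B, Some y)" using Rb Some AB(2) by simp
      then show "first_row (w @ [x]) = A @ x # B" "bumped (w @ [x]) = bumped w @ [y]"
        by (simp_all add: first_row_snoc bumped_snoc)
    qed (use AB in auto)
  qed
qed

lemma sorted_first_row: "sorted (first_row w)"
  by (induction w rule: rev_induct) (auto simp: first_row_snoc sorted_row_insert)

lemma set_first_row: "set (first_row w) \<subseteq> set w"
  by (induction w rule: bump_induct) auto

lemma length_first_row_bumped: "length (first_row w) + length (bumped w) = length w"
  by (induction w rule: bump_induct) auto

lemma first_row_eq_Nil_iff: "first_row w = [] \<longleftrightarrow> w = []"
  by (induction w rule: bump_induct) auto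

lemma length_bumped_less: "w \<noteq> [] \<Longrightarrow> length (bumped w) < length w"
  using length_first_row_bumped[of w] first_row_eq_Nil_iff[of w]
  by (cases "first_row w") auto

lemma insertion_tableau_Nil [simp]: "insertion_tableau [] = []"
  by (simp add: insertion_tableau_def)

lemma insertion_tableau_snoc:
  "insertion_tableau (w @ [x]) = tableau_insert x (insertion_tableau w)"
  by (simp add: insertion_tableau_def)

text \<open>The rows below the first one see only the entries bumped from it, in the order in which they
  are bumped.\<close>

lemma insertion_tableau_first_row:
  assumes "w \<noteq> []"
  shows "insertion_tableau w = first_row w # insertion_tableau (bumped w)"
  using assms
proof (induction w rule: rev_induct)
  case (snoc x w)
  show ?case
  proof (cases "w = []")
    case True
    then show ?thesis
      using first_row_snoc[of "[]" x] bumped_snoc[of "[]" x] insertion_tableau_snoc[of "[]" x]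
      by simp
  next
    case False
    then have "insertion_tableau w = first_row w # insertion_tableau (bumped w)"
      by (rule snoc.IH)
    then show ?thesis
      by (auto simp: insertion_tableau_snoc first_row_snoc bumped_snoc
          split: prod.splits option.splits)
  qed
qed simp

section \<open>The shape is a partition\<close>

lemma column_strict_first_row_bumped: "column_strict (first_row w) (first_row (bumped w))"
proof (induction w rule: bump_induct)
  case (extend w x)
  then show ?case by (simp add: column_strict_append)
next
  case (bump w x y A B)
  have "column_strict (A @ x # B) (fst (row_insert y (first_row (bumped w))))"
    using column_strict_row_insert[OF bump(2) bump(1)] .
  then show ?case using bump by (simp add: first_row_snoc)
qed simp

lemma shape_insertion_tableau_partition: "shape (insertion_tableau w) \<turnstile>p length w"
proof (induction w rule: length_induct)
  case (1 w)
  show ?case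
  proof (cases "w = []")
    case True
    then show ?thesis by (simp add: shape_def is_partition_of_def)
  next
    case False
    let ?u = "bumped w"
    have eq: "shape (insertion_tableau w) = length (first_row w) # shape (insertion_tableau ?u)"
      using insertion_tableau_first_row[OF False] by (simp add: shape_def)
    have IH: "shape (insertion_tableau ?u) \<turnstile>p length ?u"
      using 1 length_bumped_less[OF False] by blast
    have le: "\<forall>k\<in>set (shape (insertion_tableau ?u)). k \<le> length (first_row w)"
    proof (cases "?u = []")
      case True
      then show ?thesis by (simp add: shape_def)
    next
      case False
      have "length (first_row ?u) \<le> length (first_row w)"
        using column_strict_first_row_bumped column_strict_length by blast
      then show ?thesis
        using IH insertion_tableau_first_row[OF False]
        by (auto simp: shape_def is_partition_of_def)
    qed
    have "length (first_row w) \<ge> 1" using first_row_eq_Nil_iff[of w] False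
      by (cases "first_row w") auto
    then show ?thesis
      using IH le length_first_row_bumped[of w] by (auto simp: eq is_partition_of_def)
  qed
qed

section \<open>Monotone subsequences from the first row and the first column\<close>

text \<open>When a letter is placed to the right of column \<open>j\<close>, its left neighbour in column \<open>j\<close> is an
  earlier letter that is not greater.\<close>

lemma increasing_subseq_ending_at_entry:
  "j < length (first_row w) \<Longrightarrow>
     \<exists>e. subseq e w \<and> sorted e \<and> length e = Suc j \<and> last e = first_row w ! j"
proof (induction w arbitrary: j rule: rev_induct)
  case (snoc x w)
  have placed: "\<exists>e. subseq e (w @ [x]) \<and> sorted e \<and> length e = Suc (length A) \<and> last e = x"
    if A: "first_row w = A @ B" "\<forall>c\<in>set A. c \<le> x" for A B
  proof (cases A rule: rev_cases)
    case Nil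
    then show ?thesis by (intro exI[of _ "[x]"]) (auto simp: subseq_singleton_left)
  next
    case (snoc A' a)
    then obtain e where e: "subseq e w" "sorted e" "length e = length A" "last e = a"
      using snoc.IH[of "length A'"] A by (auto simp: nth_append)
    have "e \<noteq> []" using e(3) snoc by auto
    then obtain e' where e': "e = e' @ [a]" using e(4) by (metis append_butlast_last_id)
    have "sorted (e @ [x])" using e(2) A(2) snoc by (fastforce simp: e' sorted_append)
    then show ?thesis using e by (intro exI[of _ "e @ [x]"]) auto
  qed
  have old: "\<exists>e. subseq e (w @ [x]) \<and> sorted e \<and> length e = Suc j \<and> last e = first_row w ! j"
    if "j < length (first_row w)" for j
    using snoc.IH[OF that] subseq_rev_drop_many by blast
  obtain R' b where Rb: "row_insert x (first_row w) = (R', b)" by fastforce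
  then have row: "first_row (w @ [x]) = R'" by (simp add: first_row_snoc)
  show ?case
  proof (cases b)
    case None
    then have R': "R' = first_row w @ [x]" "\<forall>c\<in>set (first_row w). c \<le> x"
      using row_insert_NoneD Rb by blast+
    show ?thesis
    proof (cases "j = length (first_row w)")
      case True
      then show ?thesis using placed[of "first_row w" "[]"] R' row by simp
    next
      case False
      then show ?thesis using old[of j] R' row snoc.prems by (simp add: nth_append)
    qed
  next
    case (Some y)
    then obtain A B where AB: "first_row w = A @ y # B" "R' = A @ x # B" "\<forall>c\<in>set A. c \<le> x"
      using row_insert_SomeD Rb by blast
    show ?thesis
    proof (cases "j = length A")
      case True
      then show ?thesis using placed[OF AB(1,3)] AB row by simp
    next
      case False
      then show ?thesis using old[of j] AB row snoc.prems by (auto simp: nth_append nth_Cons')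
    qed
  qed
qed simp

lemma increasing_subseq_first_row:
  "\<exists>e. subseq e w \<and> sorted e \<and> length e = length (first_row w)"
proof (cases "w = []")
  case False
  then have "first_row w \<noteq> []" by (simp add: first_row_eq_Nil_iff)
  then show ?thesis
    using increasing_subseq_ending_at_entry[of "length (first_row w) - 1" w] by fastforce
qed simp

text \<open>The value \<open>v\<close> bounds all entries of the subsequence from below, so that any later letter
  less than \<open>v\<close> prolongs it.\<close>

definition decreasing_above :: "'a::linorder list \<Rightarrow> nat \<Rightarrow> 'a \<Rightarrow> bool" where
  "decreasing_above w k v \<longleftrightarrow>
     (\<exists>e. subseq e w \<and> sorted_wrt (>) e \<and> length e = k \<and> e \<noteq> [] \<and> v \<le> last e)"

lemma decreasing_above_snoc: "decreasing_above w k v \<Longrightarrow> decreasing_above (w @ [x]) k v"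
  unfolding decreasing_above_def using subseq_rev_drop_many by blast

lemma decreasing_above_mono: "decreasing_above w k v \<Longrightarrow> v' \<le> v \<Longrightarrow> decreasing_above w k v'"
  unfolding decreasing_above_def using order_trans by blast

lemma sorted_wrt_greater_snoc:
  fixes e :: "'a::linorder list"
  assumes "sorted_wrt (>) e" "e \<noteq> [] \<Longrightarrow> x < last e"
  shows "sorted_wrt (>) (e @ [x])"
  using assms by (cases e rule: rev_cases) (auto simp: sorted_wrt_append)

lemma decreasing_above_extend:
  assumes "decreasing_above w k v" "x < v"
  shows "decreasing_above (w @ [x]) (Suc k) x"
proof -
  obtain e where e: "subseq e w" "sorted_wrt (>) e" "length e = k" "e \<noteq> []" "v \<le> last e"
    using assms(1) unfolding decreasing_above_def by blast
  have "sorted_wrt (>) (e @ [x])"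
    using e assms(2) by (intro sorted_wrt_greater_snoc) auto
  then show ?thesis unfolding decreasing_above_def
    using e by (intro exI[of _ "e @ [x]"]) auto
qed

text \<open>The last claim is the goal; the first two keep the induction going. Let \<open>b\<close> be the
  last entry of the decreasing sequence \<open>d\<close> of bumped entries. Suppose that a later bumping removes
  \<open>y < b\<close> from the first row. To continue \<open>d\<close> by \<open>y\<close> there must be a decreasing subsequence of \<open>w\<close>
  that is longer by one than \<open>d\<close> and stays at or above \<open>y\<close>; then the letter that bumps \<open>y\<close> prolongs
  it once more. This is the second claim. When its entry \<open>c\<close> joins the row after \<open>b\<close> has been
  bumped, it prolongs the sequence of the first claim; otherwise \<open>c\<close> is at most the letter
  that bumped \<open>b\<close>.\<close>

lemma decreasing_above_bumped:
  assumes "subseq d (bumped w)" "sorted_wrt (>) d" "d \<noteq> []"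
  shows "decreasing_above w (length d) (last d) \<and>
    (\<forall>c\<in>set (first_row w). c < last d \<longrightarrow> decreasing_above w (Suc (length d)) c) \<and>
    (\<exists>v. decreasing_above w (Suc (length d)) v)"
  using assms
proof (induction w arbitrary: d rule: bump_induct)
  case (extend w x)
  have d: "subseq d (bumped w)" using extend by simp
  note IH = extend(1)[OF d extend.prems(2,3)]
  show ?case
    using IH decreasing_above_extend[of w "length d" "last d" x] extend(2)
    by (auto intro: decreasing_above_snoc)
next
  case (bump w x y A B)
  show ?case
  proof (cases "subseq d (bumped w)")
    case True
    note IH = bump(1)[OF True bump.prems(2,3)]
    show ?thesis
      using IH decreasing_above_extend[of w "length d" "last d" x] bump(3,4)
      by (auto intro: decreasing_above_snoc)
  next
    case False
    have "subseq d (bumped w @ [y])" using bump.prems(1) bump(7) by simp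
    then obtain d' z where dz: "d = d' @ z" "subseq d' (bumped w)" "subseq z [y]"
      by (rule subseq_appendE)
    have "z \<noteq> []" using False dz by auto
    then have d': "d = d' @ [y]" "subseq d' (bumped w)"
      using dz by (auto elim: list_emb.cases)
    have y: "y \<in> set (first_row w)" using bump(3) by simp
    have K: "decreasing_above w (length d) y"
    proof (cases "d' = []")
      case True
      have "subseq [y] w" using y set_first_row by (auto simp: subseq_singleton_left)
      then show ?thesis unfolding decreasing_above_def using True d' by (intro exI[of _ "[y]"]) auto
    next
      case False
      have dec: "sorted_wrt (>) d'" "y < last d'"
        using bump.prems(2) d' False by (auto simp: sorted_wrt_append)
      then show ?thesis using bump(1)[OF d'(2) dec(1) False] y d' by auto
    qed
    have L: "decreasing_above (w @ [x]) (Suc (length d)) x"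
      using decreasing_above_extend[OF K bump(5)] .
    have "c \<le> x" if "c \<in> set (first_row (w @ [x]))" "c < y" for c
    proof -
      have "\<forall>b\<in>set B. y \<le> b" using sorted_first_row[of w] bump(3) by (simp add: sorted_append)
      then show ?thesis using that bump(4,6) by auto
    qed
    then show ?thesis
      using K L d' by (auto intro: decreasing_above_snoc decreasing_above_mono)
  qed
qed simp

lemma decreasing_subseq_bumped:
  assumes "subseq d (bumped w)" "sorted_wrt (>) d" "d \<noteq> []"
  shows "\<exists>e. subseq e w \<and> sorted_wrt (>) e \<and> length e = Suc (length d)"
  using decreasing_above_bumped[OF assms] unfolding decreasing_above_def by blast

lemma decreasing_subseq_insertion_tableau:
  "\<exists>e. subseq e w \<and> sorted_wrt (>) e \<and> length e = length (insertion_tableau w)"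
proof (induction w rule: length_induct)
  case (1 w)
  show ?case
  proof (cases "w = []")
    case False
    then have len: "length (insertion_tableau w) = Suc (length (insertion_tableau (bumped w)))"
      by (simp add: insertion_tableau_first_row)
    obtain d where d: "subseq d (bumped w)" "sorted_wrt (>) d"
        "length d = length (insertion_tableau (bumped w))"
      using 1 length_bumped_less[OF False] by blast
    show ?thesis
    proof (cases "d = []")
      case True
      have "subseq [hd w] w" using False by (simp add: subseq_singleton_left)
      then show ?thesis using True d len by (intro exI[of _ "[hd w]"]) auto
    next
      case False
      then show ?thesis using decreasing_subseq_bumped[OF d(1,2)] d(3) len by auto
    qed
  qed simp
qed

section \<open>Cycles on which a permutation is monotone\<close>

text \<open>If \<open>x < f x\<close>, then all later iterates stay at or above \<open>f x\<close>, so \<open>x\<close> is not in its own orbit.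
  The case \<open>f x < x\<close> is dual.\<close>

lemma fixed_point_if_mono_on_orbit:
  fixes f :: "'a::linorder \<Rightarrow> 'a"
  assumes mono: "mono_on (orbit f x) f" and self: "x \<in> orbit f x"
  shows "f x = x"
proof -
  have "f x \<le> y" if "y \<in> orbit f x" "x < f x" for y
    using that
  proof (induction rule: orbit.induct)
    case (step y)
    then show ?case using mono_onD[OF mono self step(1)] by auto
  qed simp
  moreover have "y \<le> f x" if "y \<in> orbit f x" "f x < x" for y
    using that
  proof (induction rule: orbit.induct)
    case (step y)
    then show ?case using mono_onD[OF mono step(1) self] by auto
  qed simp
  ultimately show ?thesis using self by (metis linorder_neqE not_less)
qed

lemma card_orbit_le_2:
  assumes "f (f x) = x"
  shows "card (orbit f x) \<le> 2"
proof -
  have "y \<in> {x, f x}" if "y \<in> orbit f x" for y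
    using that by induction (auto simp: assms)
  then have "orbit f x \<subseteq> {x, f x}" by blast
  then have "card (orbit f x) \<le> card {x, f x}" by (intro card_mono) auto
  also have "\<dots> \<le> 2" by (simp add: card_insert_if)
  finally show ?thesis .
qed

lemma orbit_comp_self_subset: "orbit (f \<circ> f) x \<subseteq> orbit f x"
proof
  fix y assume "y \<in> orbit (f \<circ> f) x"
  then show "y \<in> orbit f x" by induction (auto intro: orbit.intros)
qed

section \<open>Counting cycles\<close>

context
  fixes S :: "'a::linorder set" and \<sigma> :: "'a \<Rightarrow> 'a"
  assumes fin: "finite S" and perm: "\<sigma> permutes S"
begin

lemma orbit_subset_carrier: "x \<in> S \<Longrightarrow> orbit \<sigma> x \<subseteq> S"
  using perm by (rule permutes_orbit_subset)

lemma self_in_orbit: "x \<in> orbit \<sigma> x"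
  using fin perm by (meson permutation_permutes permutation_self_in_orbit)

lemma orbit_eq_if_in_orbit: "y \<in> orbit \<sigma> x \<Longrightarrow> orbit \<sigma> y = orbit \<sigma> x"
  by (metis cyclic_on_orbit orbit_cyclic_eq3 fin perm permutation_permutes)

text \<open>A cycle that is not contained in \<open>I\<close> is the orbit of one of its points outside \<open>I\<close>, so there
  are at most \<open>card (S - I)\<close> such cycles.\<close>

lemma card_add_orbits_le:
  assumes I: "I \<subseteq> S"
  shows "card I + card (orbit \<sigma> ` S) \<le> card S + card {C \<in> orbit \<sigma> ` S. C \<subseteq> I}"
proof -
  let ?O = "orbit \<sigma> ` S"
  have "{C \<in> ?O. \<not> C \<subseteq> I} \<subseteq> orbit \<sigma> ` (S - I)"
  proof
    fix C assume "C \<in> {C \<in> ?O. \<not> C \<subseteq> I}"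
    then obtain x y where "x \<in> S" "C = orbit \<sigma> x" "y \<in> C" "y \<notin> I" by auto
    then show "C \<in> orbit \<sigma> ` (S - I)"
      using orbit_eq_if_in_orbit[of y x] orbit_subset_carrier[of x] by auto
  qed
  then have "card {C \<in> ?O. \<not> C \<subseteq> I} \<le> card (S - I)"
    using fin by (meson card_image_le card_mono finite_Diff finite_imageI order_trans)
  moreover have "card ?O = card {C \<in> ?O. C \<subseteq> I} + card {C \<in> ?O. \<not> C \<subseteq> I}"
  proof -
    have "?O = {C \<in> ?O. C \<subseteq> I} \<union> {C \<in> ?O. \<not> C \<subseteq> I}" by blast
    moreover have "card ({C \<in> ?O. C \<subseteq> I} \<union> {C \<in> ?O. \<not> C \<subseteq> I})
        = card {C \<in> ?O. C \<subseteq> I} + card {C \<in> ?O. \<not> C \<subseteq> I}"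
      using fin by (intro card_Un_disjoint) auto
    ultimately show ?thesis by metis
  qed
  moreover have "card (S - I) + card I = card S"
    using I fin card_Diff_subset[of I S] card_mono[of S I] finite_subset[of I S] by simp
  ultimately show ?thesis by linarith
qed

lemma card_increasing_le:
  assumes I: "I \<subseteq> S" and mono: "mono_on I \<sigma>"
  shows "card I + card (orbit \<sigma> ` S) \<le> card S + card {C \<in> orbit \<sigma> ` S. card C = 1}"
proof -
  have "card C = 1" if C: "C \<in> orbit \<sigma> ` S" "C \<subseteq> I" for C
  proof -
    obtain x where x: "C = orbit \<sigma> x" using C by blast
    then have "mono_on (orbit \<sigma> x) \<sigma>" using C mono by (auto intro: mono_on_subset)
    then have "\<sigma> x = x" using self_in_orbit by (rule fixed_point_if_mono_on_orbit)
    then show ?thesis using x by (simp add: orbit_eq_singleton_iff[THEN iffD2])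
  qed
  then have "card {C \<in> orbit \<sigma> ` S. C \<subseteq> I} \<le> card {C \<in> orbit \<sigma> ` S. card C = 1}"
    using fin by (intro card_mono) auto
  then show ?thesis using card_add_orbits_le[OF I] by linarith
qed

text \<open>On a cycle inside \<open>I\<close> the composition \<open>\<sigma> \<circ> \<sigma>\<close> is increasing. Its orbits may be smaller than
  the cycle, but they lie inside it, so \<open>\<sigma> \<circ> \<sigma>\<close> fixes every point of the cycle, whose length is
  therefore 1 or 2. Two fixed points in \<open>I\<close> would keep their order, hence the
  last summand.\<close>

lemma card_decreasing_le:
  assumes I: "I \<subseteq> S" and dec: "\<And>x y. x \<in> I \<Longrightarrow> y \<in> I \<Longrightarrow> x < y \<Longrightarrow> \<sigma> y < \<sigma> x"
  shows "card I + card (orbit \<sigma> ` S) \<le> card S + card {C \<in> orbit \<sigma> ` S. card C = 2}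
           + (if \<exists>C \<in> orbit \<sigma> ` S. card C = 1 then 1 else 0)"
proof -
  let ?O = "orbit \<sigma> ` S"
  let ?F = "{C \<in> ?O. C \<subseteq> I \<and> card C = 1}"
  have le: "\<sigma> y \<le> \<sigma> x" if "x \<in> I" "y \<in> I" "x \<le> y" for x y
    using dec[of x y] that by (cases "x = y") (auto simp: order_le_less)
  have card12: "card C = 1 \<or> card C = 2" if C: "C \<in> ?O" "C \<subseteq> I" for C
  proof -
    obtain x where x: "C = orbit \<sigma> x" "x \<in> S" using C by blast
    have sub: "orbit (\<sigma> \<circ> \<sigma>) x \<subseteq> orbit \<sigma> x" by (rule orbit_comp_self_subset)
    have "mono_on (orbit (\<sigma> \<circ> \<sigma>) x) (\<sigma> \<circ> \<sigma>)"
    proof (rule mono_onI)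
      fix a b assume ab: "a \<in> orbit (\<sigma> \<circ> \<sigma>) x" "b \<in> orbit (\<sigma> \<circ> \<sigma>) x" "a \<le> b"
      then have "a \<in> orbit \<sigma> x" "b \<in> orbit \<sigma> x" using sub by auto
      then have "a \<in> I" "b \<in> I" "\<sigma> a \<in> I" "\<sigma> b \<in> I"
        using C(2) x(1) orbit.step[of _ \<sigma> x] by auto
      then show "(\<sigma> \<circ> \<sigma>) a \<le> (\<sigma> \<circ> \<sigma>) b" using ab(3) le by simp
    qed
    moreover have "permutation (\<sigma> \<circ> \<sigma>)"
      using fin permutes_compose[OF perm perm] unfolding permutation_permutes by blast
    then have "x \<in> orbit (\<sigma> \<circ> \<sigma>) x" by (rule permutation_self_in_orbit)
    ultimately have "(\<sigma> \<circ> \<sigma>) x = x" by (rule fixed_point_if_mono_on_orbit)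
    then have "card C \<le> 2" using x card_orbit_le_2[of \<sigma> x] by simp
    moreover have "finite C" using orbit_subset_carrier[of x] x fin finite_subset by blast
    then have "card C > 0" using self_in_orbit x by (auto simp: card_gt_0_iff)
    ultimately show ?thesis by linarith
  qed
  have fixed: "\<exists>x\<in>I. C = {x} \<and> \<sigma> x = x" if C: "C \<in> ?F" for C
  proof -
    obtain x where x: "C = orbit \<sigma> x" using C by blast
    then have "C = {x}" using C self_in_orbit[of x] by (auto simp: card_1_singleton_iff)
    moreover have "\<sigma> x \<in> C" using x orbit.base by simp
    ultimately show ?thesis using C by auto
  qed
  have "C = D" if CD: "C \<in> ?F" "D \<in> ?F" for C D
  proof -
    obtain x y where "x \<in> I" "C = {x}" "\<sigma> x = x" "y \<in> I" "D = {y}" "\<sigma> y = y"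
      using fixed[OF CD(1)] fixed[OF CD(2)] by blast
    then show ?thesis using dec[of x y] dec[of y x] by (cases x y rule: linorder_cases) auto
  qed
  then have "card ?F \<le> Suc 0" using fin by (subst card_le_Suc0_iff_eq) auto
  then have F: "card ?F \<le> (if \<exists>C \<in> ?O. card C = 1 then 1 else 0)"
  proof (cases "\<exists>C \<in> ?O. card C = 1")
    case False
    then have "?F = {}" by blast
    then show ?thesis by (simp only: card.empty)
  qed simp
  have "{C \<in> ?O. C \<subseteq> I} \<subseteq> {C \<in> ?O. card C = 2} \<union> ?F" using card12 by auto
  then have "card {C \<in> ?O. C \<subseteq> I} \<le> card ({C \<in> ?O. card C = 2} \<union> ?F)"
    using fin by (intro card_mono) auto
  also have "\<dots> \<le> card {C \<in> ?O. card C = 2} + card ?F" by (rule card_Un_le)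
  finally show ?thesis using F card_add_orbits_le[OF I] by linarith
qed

end

section \<open>From subsequences and cycle types to positions and parts\<close>

lemma subseq_one_lineE:
  assumes "subseq e (one_line n \<sigma>)"
  obtains js where "e = map \<sigma> js" "sorted_wrt (<) js" "set js \<subseteq> {1..n}"
proof -
  obtain N where N: "e = nths (one_line n \<sigma>) N" using assms by (auto simp: subseq_conv_nths)
  let ?js = "nths [1..<Suc n] N"
  have "sorted_wrt (<) ?js"
    by (simp only: strict_sorted_iff sorted_nths sorted_upt distinct_nthsI distinct_upt simp_thms)
  moreover have "set ?js \<subseteq> {1..n}" by (auto dest!: in_set_nthsD simp del: upt_Suc)
  ultimately show thesis using that[of ?js] N by (simp add: one_line_def nths_map del: upt_Suc)
qed

lemma sorted_wrt_of_strict_sorted: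
  fixes x y :: "'a::linorder"
  assumes "sorted_wrt (<) js" "sorted_wrt P js" "x \<in> set js" "y \<in> set js" "x < y"
  shows "P x y"
  using assms by (induction js) (auto dest: less_asym)

lemma cycle_type_parts:
  assumes "cycle_type n \<sigma> = mset \<alpha>"
  shows "card (orbit \<sigma> ` {1..n}) = length \<alpha>"
    and "card {C \<in> orbit \<sigma> ` {1..n}. card C = k} = card {i. i < length \<alpha> \<and> \<alpha> ! i = k}"
    and "(\<exists>C \<in> orbit \<sigma> ` {1..n}. card C = k) \<longleftrightarrow> k \<in> set \<alpha>"
proof -
  let ?O = "orbit \<sigma> ` {1..n}"
  show "card ?O = length \<alpha>" using arg_cong[OF assms, of size] by (simp add: cycle_type_def)
  have "card {C \<in> ?O. card C = k} = count (cycle_type n \<sigma>) k"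
    by (simp add: cycle_type_def count_image_mset Int_def vimage_def conj_commute)
  also have "\<dots> = card {i. i < length \<alpha> \<and> \<alpha> ! i = k}"
    unfolding assms count_mset by (simp add: count_list_eq_length_filter length_filter_conv_card eq_commute)
  finally show "card {C \<in> ?O. card C = k} = card {i. i < length \<alpha> \<and> \<alpha> ! i = k}" .
  show "(\<exists>C \<in> ?O. card C = k) \<longleftrightarrow> k \<in> set \<alpha>"
  proof -
    have "set \<alpha> = card ` ?O" using arg_cong[OF assms, of set_mset] by (simp add: cycle_type_def)
    then show ?thesis by auto
  qed
qed

lemma last_partition_eq_1:
  assumes "\<alpha> \<turnstile>p n" "1 \<in> set \<alpha>"
  shows "last \<alpha> = 1"
  using assms by (cases \<alpha> rule: rev_cases) (force simp: is_partition_of_def sorted_wrt_append)+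

lemma hd_conjugate_partition:
  assumes "la \<turnstile>p n" "la \<noteq> []"
  shows "hd (conjugate la) = length la"
proof (cases la)
  case (Cons k ks)
  then have "k > 0" "filter (\<lambda>p. 0 < p) ks = ks"
    using assms by (auto simp: is_partition_of_def filter_id_conv)
  then show ?thesis using Cons by (simp add: hd_map upt_conv_Cons)
qed (use assms in simp)

section \<open>The bounds on the shape\<close>

theorem theorem2p2:
  fixes n :: nat and \<alpha> :: "nat list"
  assumes "n > 0" and "\<alpha> \<turnstile>p n"
  shows "shapes n \<alpha> \<subseteq> bound_set n \<alpha>"
proof
  fix la assume "la \<in> shapes n \<alpha>"
  then obtain \<sigma> where perm: "\<sigma> permutes {1..n}" and ct: "cycle_type n \<sigma> = mset \<alpha>"
    and "la = sh n \<sigma>" by (auto simp: shapes_def conj_class_def)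
  define w where "w = one_line n \<sigma>"
  have w: "length w = n" "w \<noteq> []" using assms(1) by (auto simp: w_def one_line_def)
  have la: "la = shape (insertion_tableau w)"
    using \<open>la = sh n \<sigma>\<close> by (simp add: sh_def w_def fst_robinson_schensted)
  then have part: "la \<turnstile>p n" using shape_insertion_tableau_partition[of w] w by simp
  have hd_la: "hd la = length (first_row w)" and la_ne: "la \<noteq> []"
    using la insertion_tableau_first_row[OF w(2)] by (auto simp: shape_def)
  note parts = cycle_type_parts[OF ct]

  obtain e where e: "subseq e w" "sorted e" "length e = hd la"
    using increasing_subseq_first_row hd_la by metis
  obtain js where js: "e = map \<sigma> js" "sorted_wrt (<) js" "set js \<subseteq> {1..n}"
    using e(1) subseq_one_lineE unfolding w_def by blast
  have "mono_on (set js) \<sigma>"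
  proof (rule mono_onI)
    fix x y assume xy: "x \<in> set js" "y \<in> set js" "x \<le> y"
    have "sorted_wrt (\<lambda>x y. \<sigma> x \<le> \<sigma> y) js" using e(2) js(1) by (simp add: sorted_wrt_map)
    then show "\<sigma> x \<le> \<sigma> y"
      using sorted_wrt_of_strict_sorted[OF js(2) _ xy(1,2)] xy(3) by (cases "x = y") auto
  qed
  then have "card (set js) + length \<alpha> \<le> n + card {i. i < length \<alpha> \<and> \<alpha> ! i = 1}"
    using card_increasing_le[OF _ perm js(3)] parts by simp
  moreover have "card (set js) = hd la"
    using e(3) js(1,2) by (simp add: distinct_card strict_sorted_iff)
  ultimately have row: "hd la + length \<alpha> \<le> n + card {i. i < length \<alpha> \<and> \<alpha> ! i = 1}"
    by simp

  obtain d where d: "subseq d w" "sorted_wrt (>) d" "length d = length la"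
    using decreasing_subseq_insertion_tableau[of w] la by (auto simp: shape_def)
  obtain ks where ks: "d = map \<sigma> ks" "sorted_wrt (<) ks" "set ks \<subseteq> {1..n}"
    using d(1) subseq_one_lineE unfolding w_def by blast
  have "sorted_wrt (\<lambda>x y. \<sigma> y < \<sigma> x) ks" using d(2) ks(1) by (simp add: sorted_wrt_map)
  then have "\<sigma> y < \<sigma> x" if "x \<in> set ks" "y \<in> set ks" "x < y" for x y
    using sorted_wrt_of_strict_sorted[OF ks(2)] that by blast
  then have "card (set ks) + length \<alpha> \<le> n + card {i. i < length \<alpha> \<and> \<alpha> ! i = 2}
      + (if 1 \<in> set \<alpha> then 1 else 0)"
    using card_decreasing_le[OF _ perm ks(3)] parts by simp
  moreover have "card (set ks) = hd (conjugate la)"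
    using d(3) ks(1,2) hd_conjugate_partition[OF part la_ne]
    by (simp add: distinct_card strict_sorted_iff)
  ultimately have column: "hd (conjugate la) + length \<alpha> \<le> n
      + card {i. i < length \<alpha> \<and> \<alpha> ! i = 2} + (if last \<alpha> = 1 then 1 else 0)"
    using last_partition_eq_1[OF assms(2)] by (simp split: if_splits)

  (* With at most n cycles, the subtraction in the bounds does not truncate. *)
  have "length \<alpha> \<le> n"
    using card_image_le[of "{1..n}" "orbit \<sigma>"] parts(1) by simp
  then have "hd la \<le> n - length \<alpha> + card {i. i < length \<alpha> \<and> \<alpha> ! i = 1}"
    and "hd (conjugate la) \<le> n - length \<alpha> + card {i. i < length \<alpha> \<and> \<alpha> ! i = 2}
      + (if last \<alpha> = 1 then 1 else 0)"
    using row column by linarith+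
  then show "la \<in> bound_set n \<alpha>" using part by (simp only: bound_set_def mem_Collect_eq)
qed

end
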